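(* Let $\Gamma$ be an infinite finitely generated discrete group of polynomial growth, and let $\mathsf{A}$ be a nonempty finite subset of $\Gamma$. Then $$h_{\mathrm{top}}(X_{\mathsf{A}})\le\frac{1}{|\mathsf{A}|}\log(|\mathsf{A}|!).$$
   Context: A finitely generated group $\Gamma$ has polynomial growth if, given a finite generating subset $S$ of $\Gamma$ with $e_\Gamma\in S=S^{-1}$ ($e_\Gamma$ the identity), there is a polynomial $g$ such that $|S^n|\le g(n)$ for all $n\in\mathbb{N}$ (independent of the choice of $S$). Such groups are amenable. $X_{\mathsf{A}}$ is the set of all $x=(x_s)_{s\in\Gamma}\in\mathsf{A}^\Gamma$ such that the map $\Gamma\to\Gamma$, $s\mapsto sx_s$, is bijective. It is a closed subset of $\mathsf{A}^\Gamma$ (product topology), invariant under the left shift action $(\lambda^sx)_t=x_{s^{-1}t}$ of $\Gamma$. $h_{\mathrm{top}}(X_{\mathsf{A}})$ is the topological entropy of this action on $X_{\mathsf{A}}$; it equals $\lim_F\frac1{|F|}\log|\pi_F(X_{\mathsf{A}})|$, where $\pi_F$ is restriction of coordinates to the nonempty finite set $F\subset\Gamma$ and the limit is taken as $F$ becomes more and more right invariant (i.e. $\lim_F\phi(F)=C$ means: for every neighbourhood $U$ of $C$ there are a nonempty finite $K\subset\Gamma$ and $\delta>0$ with $\phi(F)\in U$ whenever $|FK\vartriangle F|<\delta|F|$). *)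

theory Defs
  imports
    "HOL-Analysis.Analysis"
    "HOL-Algebra.Generated_Groups"
    "HOL-Computational_Algebra.Polynomial"
begin

definition finitely_generated :: "('g, 'b) monoid_scheme \<Rightarrow> bool" where
  "finitely_generated G \<longleftrightarrow>
     (\<exists>S. finite S \<and> S \<subseteq> carrier G \<and> generate G S = carrier G)"

primrec set_power :: "('g, 'b) monoid_scheme \<Rightarrow> 'g set \<Rightarrow> nat \<Rightarrow> 'g set" where
  "set_power G S 0 = {\<one>\<^bsub>G\<^esub>}"
| "set_power G S (Suc n) = set_power G S n <#>\<^bsub>G\<^esub> S"

(* The condition does not depend on the choice of S, so asking for one S is enough. *)
definition polynomial_growth :: "('g, 'b) monoid_scheme \<Rightarrow> bool" where
  "polynomial_growth G \<longleftrightarrow>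
     (\<exists>S. finite S \<and> S \<subseteq> carrier G \<and> generate G S = carrier G \<and>
          \<one>\<^bsub>G\<^esub> \<in> S \<and> S = (\<lambda>s. inv\<^bsub>G\<^esub> s) ` S \<and>
          (\<exists>g :: real poly. \<forall>n. real (card (set_power G S n)) \<le> poly g (real n)))"

(* Nonempty finite subsets F of G becoming more and more right invariant. The sets on the
   right form a filter base up to a factor 2 in d: |F - FK| \<le> |FK - F| always holds, and FK
   is monotone in K. *)
definition right_invariance :: "('g, 'b) monoid_scheme \<Rightarrow> 'g set filter" where
  "right_invariance G =
     (INF (K, d) \<in> {(K, d :: real). finite K \<and> K \<noteq> {} \<and> K \<subseteq> carrier G \<and> d > 0}.
        principal {F. finite F \<and> F \<noteq> {} \<and> F \<subseteq> carrier G \<and>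
                      real (card (sym_diff (F <#>\<^bsub>G\<^esub> K) F)) < d * real (card F)})"

definition is_open_cover :: "'x topology \<Rightarrow> 'x set set \<Rightarrow> bool" where
  "is_open_cover X \<U> \<longleftrightarrow> (\<forall>U\<in>\<U>. openin X U) \<and> \<Union>\<U> = topspace X"

definition cover_number :: "'x topology \<Rightarrow> 'x set set \<Rightarrow> nat" where
  "cover_number X \<U> = Inf (card ` {\<V>. \<V> \<subseteq> \<U> \<and> finite \<V> \<and> \<Union>\<V> = topspace X})"

(* The common refinement of the covers sU for s in F. *)
definition cover_join :: "('g \<Rightarrow> 'x \<Rightarrow> 'x) \<Rightarrow> 'x set set \<Rightarrow> 'g set \<Rightarrow> 'x set set" where
  "cover_join \<alpha> \<U> F = {\<Inter>s\<in>F. \<alpha> s ` V s | V. V \<in> F \<rightarrow> \<U>}"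

(* Entropy of a continuous action of an amenable group G on a compact space X, by open covers.
   Right invariance of F goes with the translates sU; replacing F by the set of inverses gives
   the convention with left invariance and the translates of U by inverses. The limit over F
   exists by the Ornstein-Weiss lemma, so Limsup is its value. *)
definition topological_entropy ::
    "('g, 'b) monoid_scheme \<Rightarrow> 'x topology \<Rightarrow> ('g \<Rightarrow> 'x \<Rightarrow> 'x) \<Rightarrow> ereal" where
  "topological_entropy G X \<alpha> =
     (SUP \<U> \<in> {\<U>. is_open_cover X \<U>}.
        Limsup (right_invariance G)
          (\<lambda>F. ereal (ln (real (cover_number X (cover_join \<alpha> \<U> F))) / real (card F))))"

definition restricted_perms :: "('g, 'b) monoid_scheme \<Rightarrow> 'g set \<Rightarrow> ('g \<Rightarrow> 'g) set" where
  "restricted_perms G A =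
     {x \<in> carrier G \<rightarrow>\<^sub>E A. bij_betw (\<lambda>s. s \<otimes>\<^bsub>G\<^esub> x s) (carrier G) (carrier G)}"

definition restricted_perm_space :: "('g, 'b) monoid_scheme \<Rightarrow> 'g set \<Rightarrow> ('g \<Rightarrow> 'g) topology" where
  "restricted_perm_space G A =
     subtopology (product_topology (\<lambda>_. discrete_topology A) (carrier G)) (restricted_perms G A)"

definition left_shift :: "('g, 'b) monoid_scheme \<Rightarrow> 'g \<Rightarrow> ('g \<Rightarrow> 'g) \<Rightarrow> ('g \<Rightarrow> 'g)" where
  "left_shift G s x = (\<lambda>t\<in>carrier G. x (inv\<^bsub>G\<^esub> s \<otimes>\<^bsub>G\<^esub> t))"

end

theory Submission
  imports Defs
begin

text \<open>By compactness, every open cover is refined by the cylinders on some finite \<open>K\<close>, so the cover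
  number over \<open>F\<close> is at most the number of patterns on \<open>E = F K\<close>. A pattern \<open>p\<close> on \<open>E\<close> is
  determined by the injection \<open>s \<mapsto> s p(s)\<close> of \<open>E\<close> into \<open>E A\<close>. If \<open>F\<close> is almost invariant
  under \<open>K A\<close>, then \<open>E A\<close> has few more elements than \<open>E\<close>, so there are subexponentially many
  choices for the image \<open>T\<close>; for each \<open>T\<close> the injections are counted by the permanent of a 0-1
  matrix with row sums at most \<open>|A|\<close>, to which the Bregman--Minc inequality applies.\<close>

section \<open>Entropy and the Bregman--Minc inequality\<close>

text \<open>For \<open>\<sigma>\<close> uniform in \<open>S\<close>, the value
  \<open>f \<sigma>\<close> has entropy at most \<open>ln (card K)\<close>; multiplying by
  \<open>card S\<close> gives this form. It takes the place of the convexity inequality in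
  Schrijver's proof, with \<open>f\<close> sending \<open>\<sigma>\<close> to its value in one
  row.\<close>

lemma fibre_entropy_bound:
  assumes "finite S" "finite K" "f ` S \<subseteq> K"
  shows "real (card S) * ln (real (card S)) \<le> real (card S) * ln (real (card K)) +
           (\<Sum>\<sigma>\<in>S. ln (real (card {\<tau>\<in>S. f \<tau> = f \<sigma>})))"
proof (cases "S = {}")
  case False
  define P where "P = real (card S)"
  define r where "r = real (card K)"
  define p where "p k = real (card {\<tau>\<in>S. f \<tau> = k})" for k
  have "K \<noteq> {}" using assms False by auto
  then have pos: "P > 0" "r > 0"
    using assms False by (auto simp: P_def r_def card_gt_0_iff)
  have ppos: "p (f \<sigma>) > 0" if "\<sigma> \<in> S" for \<sigma>
    using that assms by (auto simp: p_def card_gt_0_iff)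
  \<comment> \<open>Grouped by the value of \<open>f\<close>, each nonempty fibre contributes
    exactly \<open>P / r\<close>, and there are at most \<open>r\<close> such fibres. This is the
    total needed for applying \<open>ln y \<le> y - 1\<close> to
    \<open>y = P / (r * p (f \<sigma>))\<close> termwise.\<close>
  have "(\<Sum>\<sigma>\<in>S. P / (r * p (f \<sigma>))) = (\<Sum>k\<in>f ` S. \<Sum>\<sigma>\<in>{\<tau>\<in>S. f \<tau> = k}. P / (r * p (f \<sigma>)))"
    using assms by (subst sum.image_gen[of S _ f]) auto
  also have "\<dots> = (\<Sum>k\<in>f ` S. P / r)"
  proof (rule sum.cong)
    fix k assume "k \<in> f ` S"
    then have "p k > 0" using ppos by auto
    have "(\<Sum>\<sigma>\<in>{\<tau>\<in>S. f \<tau> = k}. P / (r * p (f \<sigma>))) = (\<Sum>\<sigma>\<in>{\<tau>\<in>S. f \<tau> = k}. P / (r * p k))"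
      by (intro sum.cong) auto
    also have "\<dots> = p k * (P / (r * p k))" by (simp add: p_def)
    also have "\<dots> = P / r" using \<open>p k > 0\<close> pos by simp
    finally show "(\<Sum>\<sigma>\<in>{\<tau>\<in>S. f \<tau> = k}. P / (r * p (f \<sigma>))) = P / r" .
  qed simp
  also have "\<dots> = real (card (f ` S)) * (P / r)" by simp
  also have "\<dots> \<le> r * (P / r)"
    using pos assms by (intro mult_right_mono) (auto simp: r_def intro: card_mono)
  also have "\<dots> = P" using pos by simp
  finally have sum_le: "(\<Sum>\<sigma>\<in>S. P / (r * p (f \<sigma>))) \<le> P" .
  have "(\<Sum>\<sigma>\<in>S. ln P - ln r - ln (p (f \<sigma>))) \<le> (\<Sum>\<sigma>\<in>S. P / (r * p (f \<sigma>)) - 1)"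
  proof (rule sum_mono)
    fix \<sigma> assume "\<sigma> \<in> S"
    note q = ppos[OF this]
    have "ln (P / (r * p (f \<sigma>))) \<le> P / (r * p (f \<sigma>)) - 1"
      using pos q by (intro ln_le_minus_one) auto
    then show "ln P - ln r - ln (p (f \<sigma>)) \<le> P / (r * p (f \<sigma>)) - 1"
      using pos q by (simp add: ln_div ln_mult)
  qed
  also have "\<dots> \<le> 0" using sum_le by (simp add: sum_subtractf P_def)
  finally have "P * ln P - P * ln r - (\<Sum>\<sigma>\<in>S. ln (p (f \<sigma>))) \<le> 0"
    by (simp add: sum_subtractf P_def right_diff_distrib)
  then show ?thesis by (simp add: P_def r_def p_def)
qed simp

text \<open>The logarithm of \<open>(r!)^(1/r)\<close>, the factor of a row with sum
  \<open>r\<close> in the Bregman--Minc bound. Division by zero gives the value 0 at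
  \<open>r = 0\<close>, so that \<open>r * ln_fact_mean r = ln (r!)\<close> and monotonicity hold
  there too.\<close>

definition ln_fact_mean :: "nat \<Rightarrow> real" where
  "ln_fact_mean r = ln (fact r) / real r"

lemma mult_ln_fact_mean: "real r * ln_fact_mean r = ln (fact r)"
  by (simp add: ln_fact_mean_def)

lemma ln_fact_mean_nonneg: "ln_fact_mean r \<ge> 0"
  by (simp add: ln_fact_mean_def)

text \<open>The geometric mean of \<open>1, ..., r\<close> does not decrease when the factor
  \<open>r + 1\<close> joins; after clearing denominators this is
  \<open>r! \<le> (r + 1)^r\<close>.\<close>

lemma mono_ln_fact_mean: "mono ln_fact_mean"
  unfolding mono_iff_le_Suc
proof
  fix r
  show "ln_fact_mean r \<le> ln_fact_mean (Suc r)"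
  proof (cases "r = 0")
    case False
    have "(fact r :: real) \<le> real (r ^ r)"
      using fact_le_power[of r, where 'a = real] by simp
    also have "\<dots> \<le> real (Suc r) ^ r"
      unfolding of_nat_power by (intro power_mono) auto
    finally have "ln (fact r) \<le> ln (real (Suc r) ^ r)"
      by (subst ln_le_cancel_iff) auto
    then have *: "ln (fact r) \<le> real r * ln (real (Suc r))"
      by (simp add: ln_realpow)
    have "ln (fact (Suc r) :: real) = ln (real (Suc r)) + ln (fact r)"
      by (simp only: fact_Suc of_nat_id) (subst ln_mult, auto)
    with * False show ?thesis
      by (simp add: ln_fact_mean_def divide_simps) (simp add: algebra_simps)
  qed (simp add: ln_fact_mean_def)
qed

text \<open>When \<open>I\<close> and \<open>T\<close> are finite of equal size, the number of these
  is the permanent of the 0-1 matrix with rows \<open>I\<close>, columns \<open>T\<close> and ones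
  at the \<open>j \<in> R i\<close>. The sets \<open>R i\<close> may leave \<open>T\<close>, so
  passing to a minor changes only \<open>I\<close> and \<open>T\<close>.\<close>

definition bij_selections :: "('i \<Rightarrow> 'j set) \<Rightarrow> 'i set \<Rightarrow> 'j set \<Rightarrow> ('i \<Rightarrow> 'j) set" where
  "bij_selections R I T = {\<sigma> \<in> (\<Pi>\<^sub>E i\<in>I. R i). bij_betw \<sigma> I T}"

lemma bij_selectionsD:
  assumes "\<sigma> \<in> bij_selections R I T"
  shows "bij_betw \<sigma> I T" "\<And>i. i \<in> I \<Longrightarrow> \<sigma> i \<in> R i \<inter> T" "\<sigma> \<in> extensional I"
  using assms by (auto simp: bij_selections_def PiE_def bij_betw_def)

lemma finite_bij_selections:
  assumes "finite I" "finite T"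
  shows "finite (bij_selections R I T)"
proof (rule finite_subset)
  show "bij_selections R I T \<subseteq> I \<rightarrow>\<^sub>E T"
    using bij_selectionsD[of _ R I T] by (auto simp: PiE_def)
  show "finite (I \<rightarrow>\<^sub>E T)" using assms by (simp add: finite_PiE)
qed

text \<open>One term of the expansion of the permanent along row \<open>i\<close>: restricting
  \<open>\<sigma>\<close> to the other rows loses nothing, as \<open>\<sigma> i\<close> is known to
  be \<open>k\<close>, and lands in the minor without row \<open>i\<close> and column
  \<open>k\<close>.\<close>

lemma card_bij_selections_fibre:
  assumes "finite I" "finite T" "i \<in> I"
  shows "card {\<sigma> \<in> bij_selections R I T. \<sigma> i = k} \<le> card (bij_selections R (I - {i}) (T - {k}))"
proof (rule card_inj_on_le)
  let ?\<phi> = "\<lambda>\<sigma>. restrict \<sigma> (I - {i})"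
  show "?\<phi> ` {\<sigma> \<in> bij_selections R I T. \<sigma> i = k} \<subseteq> bij_selections R (I - {i}) (T - {k})"
  proof safe
    fix \<sigma> assume \<sigma>: "\<sigma> \<in> bij_selections R I T"
    have "bij_betw \<sigma> (I - {i}) (T - {\<sigma> i})"
      using bij_selectionsD(1)[OF \<sigma>] assms(3) by (intro bij_betw_DiffI) (auto simp: bij_betw_def)
    then have "bij_betw (?\<phi> \<sigma>) (I - {i}) (T - {\<sigma> i})"
      by (rule bij_betw_cong[THEN iffD1, rotated]) auto
    then show "?\<phi> \<sigma> \<in> bij_selections R (I - {i}) (T - {\<sigma> i})"
      using bij_selectionsD(2)[OF \<sigma>] by (auto simp: bij_selections_def)
  qed
  show "inj_on ?\<phi> {\<sigma> \<in> bij_selections R I T. \<sigma> i = k}"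
  proof (rule inj_onI, clarsimp)
    fix \<sigma> \<tau> assume *: "\<sigma> \<in> bij_selections R I T" "\<tau> \<in> bij_selections R I T"
      "?\<phi> \<sigma> = ?\<phi> \<tau>" "\<tau> i = \<sigma> i"
    have "\<sigma> j = \<tau> j" if "j \<in> I" for j
      using fun_cong[OF *(3), of j] *(4) that by (cases "j = i") auto
    then show "\<sigma> = \<tau>"
      using bij_selectionsD(3)[OF *(1)] bij_selectionsD(3)[OF *(2)] by (intro extensionalityI)
  qed
  show "finite (bij_selections R (I - {i}) (T - {k}))"
    using assms by (simp add: finite_bij_selections)
qed

text \<open>This is the Bregman--Minc bound for the permanent of the incidence matrix of \<open>R\<close>; the
  argument is Schrijver's, with logarithms taken.\<close>

theorem bregman_minc:
  assumes "finite I" "finite T" "bij_selections R I T \<noteq> {}"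
  shows "ln (real (card (bij_selections R I T))) \<le> (\<Sum>i\<in>I. ln_fact_mean (card (R i \<inter> T)))"
  using assms
proof (induction "card I" arbitrary: I T)
  case 0
  then have "I = {}" by simp
  then have "bij_selections R I T \<subseteq> {\<lambda>_. undefined}"
    by (auto simp: bij_selections_def)
  then have "card (bij_selections R I T) \<le> 1"
    by (metis card.empty card_mono card_insert_disjoint empty_iff finite.emptyI finite.insertI One_nat_def)
  then show ?case using \<open>I = {}\<close> 0
    by (cases "card (bij_selections R I T) = 0") auto
next
  case (Suc m)
  define S where "S = bij_selections R I T"
  define n where "n = card I"
  define P where "P = real (card S)"
  define r where "r i = card (R i \<inter> T)" for i
  define G where "G = (\<Sum>i\<in>I. ln_fact_mean (r i))"
  note fin = \<open>finite I\<close> \<open>finite T\<close>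
  have finS: "finite S" unfolding S_def using fin by (rule finite_bij_selections)
  have "P > 0" "n > 0" using Suc finS by (auto simp: P_def n_def S_def card_gt_0_iff)
  \<comment> \<open>For a fixed row \<open>j\<close>, let the deleted column
    \<open>\<sigma> i\<close> vary over all \<open>i \<noteq> j\<close>. It lies in
    \<open>R j\<close> exactly \<open>r j - 1\<close> times, since \<open>\<sigma> j\<close> is left
    out, and then lowers the row sum by one; the other \<open>n - r j\<close> times the row sum
    stays. Adding \<open>ln (r j)\<close> completes \<open>ln ((r j - 1)!)\<close> to
    \<open>ln ((r j)!)\<close>, and everything becomes a multiple of
    \<open>ln_fact_mean (r j)\<close>.\<close>
  have row: "(\<Sum>i\<in>I - {j}. ln_fact_mean (card (R j \<inter> (T - {\<sigma> i})))) + ln (real (r j))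
      = real n * ln_fact_mean (r j)"
    if \<sigma>: "\<sigma> \<in> S" and j: "j \<in> I" for \<sigma> j
  proof -
    have bij: "bij_betw \<sigma> (I - {j}) (T - {\<sigma> j})"
      using bij_selectionsD(1)[OF \<sigma>[unfolded S_def]] j
      by (intro bij_betw_DiffI) (auto simp: bij_betw_def)
    have \<sigma>j: "\<sigma> j \<in> R j \<inter> T" using bij_selectionsD(2)[OF \<sigma>[unfolded S_def]] j by blast
    have rpos: "r j > 0" using \<sigma>j fin by (auto simp: r_def card_gt_0_iff)
    have cT: "card T = n"
      using bij_betw_same_card[OF bij_selectionsD(1)[OF \<sigma>[unfolded S_def]]] by (simp add: n_def)
    have rle: "r j \<le> n" unfolding r_def cT[symmetric] using fin by (auto intro: card_mono)
    have "(\<Sum>i\<in>I - {j}. ln_fact_mean (card (R j \<inter> (T - {\<sigma> i}))))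
        = (\<Sum>t\<in>T - {\<sigma> j}. ln_fact_mean (card (R j \<inter> (T - {t}))))"
      by (rule sum.reindex_bij_betw[OF bij])
    also have "T - {\<sigma> j} = (R j \<inter> T - {\<sigma> j}) \<union> (T - R j)"
      using \<sigma>j by auto
    also have "(\<Sum>t\<in>\<dots>. ln_fact_mean (card (R j \<inter> (T - {t}))))
       = (\<Sum>t\<in>R j \<inter> T - {\<sigma> j}. ln_fact_mean (card (R j \<inter> (T - {t}))))
         + (\<Sum>t\<in>T - R j. ln_fact_mean (card (R j \<inter> (T - {t}))))"
      using fin by (intro sum.union_disjoint) auto
    also have "(\<Sum>t\<in>R j \<inter> T - {\<sigma> j}. ln_fact_mean (card (R j \<inter> (T - {t}))))
        = (\<Sum>t\<in>R j \<inter> T - {\<sigma> j}. ln_fact_mean (r j - 1))"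
    proof (rule sum.cong)
      fix t assume "t \<in> R j \<inter> T - {\<sigma> j}"
      moreover have "R j \<inter> (T - {t}) = R j \<inter> T - {t}" by auto
      ultimately show "ln_fact_mean (card (R j \<inter> (T - {t}))) = ln_fact_mean (r j - 1)"
        using fin by (simp add: r_def)
    qed simp
    also have "\<dots> = real (r j - 1) * ln_fact_mean (r j - 1)"
      using \<sigma>j fin by (simp add: r_def)
    also have "\<dots> = ln (fact (r j - 1))" by (rule mult_ln_fact_mean)
    also have "(\<Sum>t\<in>T - R j. ln_fact_mean (card (R j \<inter> (T - {t}))))
        = (\<Sum>t\<in>T - R j. ln_fact_mean (r j))"
    proof (rule sum.cong)
      fix t assume "t \<in> T - R j"
      then have "R j \<inter> (T - {t}) = R j \<inter> T" by auto
      then show "ln_fact_mean (card (R j \<inter> (T - {t}))) = ln_fact_mean (r j)"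
        by (simp add: r_def)
    qed simp
    also have "\<dots> = real (n - r j) * ln_fact_mean (r j)"
    proof -
      have "card (T - R j) = card T - card (T \<inter> R j)" using fin by (intro card_Diff_subset_Int) auto
      then show ?thesis by (simp add: cT r_def Int_commute)
    qed
    finally have eq: "(\<Sum>i\<in>I - {j}. ln_fact_mean (card (R j \<inter> (T - {\<sigma> i})))) + ln (real (r j))
      = ln (fact (r j - 1)) + real (n - r j) * ln_fact_mean (r j) + ln (real (r j))" by simp
    have "ln (fact (r j - 1)) + ln (real (r j)) = ln (fact (r j) :: real)"
      using rpos by (subst fact_reduce[of "r j"]) (auto simp: ln_mult)
    also have "\<dots> = real (r j) * ln_fact_mean (r j)" by (rule mult_ln_fact_mean[symmetric])
    finally have fac: "ln (fact (r j - 1)) + ln (real (r j)) = real (r j) * ln_fact_mean (r j)" .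
    have "real (n - r j) = real n - real (r j)" using rle by simp
    with eq fac show ?thesis by (simp add: algebra_simps)
  qed
  \<comment> \<open>The induction hypothesis for the minor without row \<open>i\<close> and column
    \<open>\<sigma> i\<close>; it is nonzero because \<open>\<sigma>\<close> itself restricts to one
    of its selections.\<close>
  have minor: "ln (real (card {\<tau>\<in>S. \<tau> i = \<sigma> i}))
      \<le> (\<Sum>j\<in>I - {i}. ln_fact_mean (card (R j \<inter> (T - {\<sigma> i}))))" if "\<sigma> \<in> S" "i \<in> I" for \<sigma> i
  proof -
    let ?S' = "bij_selections R (I - {i}) (T - {\<sigma> i})"
    have le: "card {\<tau>\<in>S. \<tau> i = \<sigma> i} \<le> card ?S'"
      unfolding S_def using fin that by (intro card_bij_selections_fibre)
    have pos: "card {\<tau>\<in>S. \<tau> i = \<sigma> i} > 0"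
      using that finS by (auto simp: card_gt_0_iff)
    then have "ln (real (card {\<tau>\<in>S. \<tau> i = \<sigma> i})) \<le> ln (real (card ?S'))"
      using le by (subst ln_le_cancel_iff) auto
    also have "\<dots> \<le> (\<Sum>j\<in>I - {i}. ln_fact_mean (card (R j \<inter> (T - {\<sigma> i}))))"
    proof (rule Suc.hyps(1))
      show "m = card (I - {i})" using Suc.hyps(2) that fin by simp
      show "?S' \<noteq> {}" using le pos by auto
    qed (use fin in auto)
    finally show ?thesis .
  qed
  \<comment> \<open>Expanding along a single row would not give the bound; the entropy estimate is
    summed over all rows \<open>i\<close>, and after exchanging sums each \<open>\<sigma>\<close> is
    treated separately.\<close>
  have "real n * (P * ln P) = (\<Sum>i\<in>I. P * ln P)" by (simp add: n_def)
  also have "\<dots> \<le> (\<Sum>i\<in>I. P * ln (real (r i)) + (\<Sum>\<sigma>\<in>S. ln (real (card {\<tau>\<in>S. \<tau> i = \<sigma> i}))))"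
    unfolding P_def r_def
  proof (intro sum_mono fibre_entropy_bound)
    show "(\<lambda>\<sigma>. \<sigma> i) ` S \<subseteq> R i \<inter> T" if "i \<in> I" for i
      using bij_selectionsD(2)[OF _ that] unfolding S_def by blast
  qed (use finS fin in auto)
  also have "\<dots> = (\<Sum>i\<in>I. \<Sum>\<sigma>\<in>S. ln (real (r i)) + ln (real (card {\<tau>\<in>S. \<tau> i = \<sigma> i})))"
    by (simp add: sum.distrib P_def)
  also have "\<dots> = (\<Sum>\<sigma>\<in>S. \<Sum>i\<in>I. ln (real (r i)) + ln (real (card {\<tau>\<in>S. \<tau> i = \<sigma> i})))"
    by (rule sum.swap)
  also have "\<dots> \<le> (\<Sum>\<sigma>\<in>S. real n * G)"
  proof (rule sum_mono)
    fix \<sigma> assume \<sigma>: "\<sigma> \<in> S"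
    have "(\<Sum>i\<in>I. ln (real (r i)) + ln (real (card {\<tau>\<in>S. \<tau> i = \<sigma> i})))
        \<le> (\<Sum>i\<in>I. ln (real (r i)) + (\<Sum>j\<in>I - {i}. ln_fact_mean (card (R j \<inter> (T - {\<sigma> i})))))"
      using minor[OF \<sigma>] by (intro sum_mono add_left_mono) auto
    also have "\<dots> = (\<Sum>i\<in>I. ln (real (r i)))
        + (\<Sum>i\<in>I. \<Sum>j\<in>I - {i}. ln_fact_mean (card (R j \<inter> (T - {\<sigma> i}))))"
      by (simp add: sum.distrib)
    \<comment> \<open>The pairs \<open>i \<noteq> j\<close> are regrouped by the surviving row
      \<open>j\<close> instead of the deleted row \<open>i\<close>, to match
      \<open>row\<close>.\<close>
    also have "(\<Sum>i\<in>I. \<Sum>j\<in>I - {i}. ln_fact_mean (card (R j \<inter> (T - {\<sigma> i}))))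
        = (\<Sum>i\<in>I. \<Sum>j\<in>{j\<in>I. j \<noteq> i}. ln_fact_mean (card (R j \<inter> (T - {\<sigma> i}))))"
      by (intro sum.cong) auto
    also have "\<dots> = (\<Sum>j\<in>I. \<Sum>i\<in>{i\<in>I. j \<noteq> i}. ln_fact_mean (card (R j \<inter> (T - {\<sigma> i}))))"
      using fin by (intro sum.swap_restrict) auto
    also have "\<dots> = (\<Sum>j\<in>I. \<Sum>i\<in>I - {j}. ln_fact_mean (card (R j \<inter> (T - {\<sigma> i}))))"
      by (intro sum.cong) auto
    also have "(\<Sum>i\<in>I. ln (real (r i))) + \<dots>
        = (\<Sum>j\<in>I. (\<Sum>i\<in>I - {j}. ln_fact_mean (card (R j \<inter> (T - {\<sigma> i})))) + ln (real (r j)))"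
      by (simp add: sum.distrib)
    also have "\<dots> = real n * G"
      using row[OF \<sigma>] by (simp add: G_def sum_distrib_left)
    finally show "(\<Sum>i\<in>I. ln (real (r i)) + ln (real (card {\<tau>\<in>S. \<tau> i = \<sigma> i}))) \<le> real n * G" .
  qed
  also have "\<dots> = real n * (P * G)" by (simp add: P_def)
  finally have "ln P \<le> G" using \<open>P > 0\<close> \<open>n > 0\<close> by simp
  then show ?case by (simp add: P_def S_def G_def r_def)
qed

section \<open>Counting injections with restricted values\<close>

text \<open>A single term of the binomial expansion of \<open>(x + 1)^N\<close> is at most the
  whole. With \<open>x\<close> small and \<open>k\<close> a small enough fraction of
  \<open>N\<close>, the bound is a small multiple of \<open>N\<close>; \<open>x\<close> stays free
  so that no optimal value has to be found.\<close>

lemma ln_binomial_le: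
  assumes "k \<le> N" and "0 < x" "x \<le> (1::real)"
  shows "ln (real (N choose k)) \<le> real N * x + real k * ln (1 / x)"
proof -
  have "real (N choose k) * x ^ k \<le> (\<Sum>j\<le>N. real (N choose j) * x ^ j * 1 ^ (N - j))"
    using member_le_sum[of k "{..N}" "\<lambda>j. real (N choose j) * x ^ j * 1 ^ (N - j)"] assms by auto
  also have "\<dots> = (x + 1) ^ N" by (rule binomial_ring[symmetric])
  finally have "ln (real (N choose k) * x ^ k) \<le> ln ((x + 1) ^ N)"
    using assms by (subst ln_le_cancel_iff) auto
  then have "ln (real (N choose k)) + real k * ln x \<le> real N * ln (x + 1)"
    using assms by (simp add: ln_mult ln_realpow)
  also have "\<dots> \<le> real N * x"
    using assms by (intro mult_left_mono) (auto intro: order.trans[OF ln_add_one_self_le_self] simp: add.commute)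
  finally show ?thesis using assms by (simp add: ln_div)
qed

text \<open>Sort the injections by their image \<open>T\<close>, a subset of \<open>W\<close> of
  size \<open>card E\<close>. The binomial coefficient counts the images, and
  \<open>bregman_minc\<close> bounds each class, with row sums
  \<open>card (R i \<inter> T) \<le> m\<close>.\<close>

lemma card_inj_selections:
  assumes "finite E" "finite W" "\<And>i. i \<in> E \<Longrightarrow> R i \<subseteq> W" "\<And>i. i \<in> E \<Longrightarrow> card (R i) \<le> m"
  shows "real (card {\<sigma> \<in> (\<Pi>\<^sub>E i\<in>E. R i). inj_on \<sigma> E})
           \<le> real (card W choose card E) * exp (real (card E) * ln_fact_mean m)"
proof -
  let ?S = "{\<sigma> \<in> (\<Pi>\<^sub>E i\<in>E. R i). inj_on \<sigma> E}"
  let ?\<T> = "{T. T \<subseteq> W \<and> card T = card E}"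
  have fT: "finite ?\<T>" using assms by auto
  have "?S \<subseteq> (\<Union>T\<in>?\<T>. bij_selections R E T)"
  proof
    fix \<sigma> assume \<sigma>: "\<sigma> \<in> ?S"
    then have "\<sigma> \<in> bij_selections R E (\<sigma> ` E)" by (auto simp: bij_selections_def bij_betw_def)
    moreover have "\<sigma> ` E \<in> ?\<T>" using \<sigma> assms(3) by (force simp: card_image PiE_def Pi_def)
    ultimately show "\<sigma> \<in> (\<Union>T\<in>?\<T>. bij_selections R E T)" by blast
  qed
  moreover have "finite (\<Union>T\<in>?\<T>. bij_selections R E T)"
    using fT assms by (intro finite_UN_I finite_bij_selections) (auto intro: finite_subset)
  ultimately have "card ?S \<le> card (\<Union>T\<in>?\<T>. bij_selections R E T)" by (rule card_mono[rotated])
  also have "\<dots> \<le> (\<Sum>T\<in>?\<T>. card (bij_selections R E T))" using fT by (rule card_UN_le)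
  finally have "real (card ?S) \<le> (\<Sum>T\<in>?\<T>. real (card (bij_selections R E T)))"
    by (simp flip: of_nat_sum)
  also have "\<dots> \<le> (\<Sum>T\<in>?\<T>. exp (real (card E) * ln_fact_mean m))"
  proof (rule sum_mono)
    fix T assume "T \<in> ?\<T>"
    then have fin: "finite T" using assms by (auto intro: finite_subset)
    show "real (card (bij_selections R E T)) \<le> exp (real (card E) * ln_fact_mean m)"
    proof (cases "bij_selections R E T = {}")
      case False
      have "ln (real (card (bij_selections R E T))) \<le> (\<Sum>i\<in>E. ln_fact_mean (card (R i \<inter> T)))"
        using assms(1) fin False by (rule bregman_minc)
      also have "\<dots> \<le> (\<Sum>i\<in>E. ln_fact_mean m)"
      proof (rule sum_mono)
        fix i assume i: "i \<in> E"
        have "card (R i \<inter> T) \<le> card (R i)"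
          using assms(2) assms(3)[OF i] by (intro card_mono) (auto intro: finite_subset)
        then show "ln_fact_mean (card (R i \<inter> T)) \<le> ln_fact_mean m"
          using assms(4)[OF i] by (intro monoD[OF mono_ln_fact_mean]) simp
      qed
      finally have "ln (real (card (bij_selections R E T))) \<le> real (card E) * ln_fact_mean m" by simp
      moreover have "card (bij_selections R E T) > 0"
        using False finite_bij_selections[OF assms(1) fin] by (simp add: card_gt_0_iff)
      ultimately show ?thesis by (metis exp_le_cancel_iff exp_ln of_nat_0_less_iff)
    qed simp
  qed
  also have "\<dots> = real (card W choose card E) * exp (real (card E) * ln_fact_mean m)"
    using assms(2) by (simp add: n_subsets)
  finally show ?thesis .
qed


section \<open>Sets determined by finitely many coordinates\<close>

lemma openin_finitely_determined:
  assumes "finite K"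
    and "\<And>x y. x \<in> I \<rightarrow>\<^sub>E A \<Longrightarrow> y \<in> I \<rightarrow>\<^sub>E A \<Longrightarrow> (\<And>t. t \<in> K \<Longrightarrow> x t = y t) \<Longrightarrow> Q x \<Longrightarrow> Q y"
  shows "openin (product_topology (\<lambda>_. discrete_topology A) I) {x \<in> I \<rightarrow>\<^sub>E A. Q x}"
proof (subst openin_subopen, intro ballI)
  fix x assume x: "x \<in> {x \<in> I \<rightarrow>\<^sub>E A. Q x}"
  let ?C = "\<Pi>\<^sub>E t\<in>I. if t \<in> K then {x t} else A"
  have "openin (product_topology (\<lambda>_. discrete_topology A) I) ?C"
    unfolding openin_PiE_gen
    using x assms(1) by (auto intro: finite_subset[of _ K])
  moreover have "x \<in> ?C" using x by auto
  moreover have "?C \<subseteq> {x \<in> I \<rightarrow>\<^sub>E A. Q x}"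
  proof
    fix y assume y: "y \<in> ?C"
    have yA: "y \<in> I \<rightarrow>\<^sub>E A"
    proof (rule PiE_I)
      show "y t \<in> A" if "t \<in> I" for t
        using PiE_mem[OF y that] x that by (auto split: if_splits)
      show "y t = undefined" if "t \<notin> I" for t using PiE_arb[OF y that] .
    qed
    \<comment> \<open>The set \<open>K\<close> may leave \<open>I\<close>; there both functions take
      the value \<open>undefined\<close>.\<close>
    have "x t = y t" if "t \<in> K" for t
    proof (cases "t \<in> I")
      case True
      then show ?thesis using PiE_mem[OF y True] that by simp
    next
      case False
      then show ?thesis using PiE_arb[OF yA False] x PiE_arb[of x I "\<lambda>_. A" t] by simp
    qed
    then show "y \<in> {x \<in> I \<rightarrow>\<^sub>E A. Q x}" using assms(2)[of x y] x yA by blast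
  qed
  ultimately show "\<exists>T. openin (product_topology (\<lambda>_. discrete_topology A) I) T \<and> x \<in> T \<and>
      T \<subseteq> {x \<in> I \<rightarrow>\<^sub>E A. Q x}" by blast
qed

lemma closedin_finitely_determined:
  assumes "finite K"
    and "\<And>x y. x \<in> I \<rightarrow>\<^sub>E A \<Longrightarrow> y \<in> I \<rightarrow>\<^sub>E A \<Longrightarrow> (\<And>t. t \<in> K \<Longrightarrow> x t = y t) \<Longrightarrow> Q x \<Longrightarrow> Q y"
  shows "closedin (product_topology (\<lambda>_. discrete_topology A) I) {x \<in> I \<rightarrow>\<^sub>E A. Q x}"
proof -
  have "openin (product_topology (\<lambda>_. discrete_topology A) I) {x \<in> I \<rightarrow>\<^sub>E A. \<not> Q x}"
    using assms(1)
  proof (rule openin_finitely_determined)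
    fix x y assume *: "x \<in> I \<rightarrow>\<^sub>E A" "y \<in> I \<rightarrow>\<^sub>E A" "\<And>t. t \<in> K \<Longrightarrow> x t = y t" "\<not> Q x"
    show "\<not> Q y" using assms(2)[of y x] * by metis
  qed
  moreover have "(I \<rightarrow>\<^sub>E A) - {x \<in> I \<rightarrow>\<^sub>E A. Q x} = {x \<in> I \<rightarrow>\<^sub>E A. \<not> Q x}" by auto
  ultimately show ?thesis by (simp add: closedin_def)
qed

lemma topspace_restricted_perm_space [simp]:
  "topspace (restricted_perm_space G A) = restricted_perms G A"
  by (auto simp: restricted_perm_space_def restricted_perms_def)

section \<open>Compactness of the space and refinement of covers by cylinders\<close>

context group
begin

lemma bij_betw_left_mult: "a \<in> carrier G \<Longrightarrow> bij_betw (\<lambda>t. a \<otimes> t) (carrier G) (carrier G)"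
  by (rule bij_betw_byWitness[where f' = "\<lambda>t. inv a \<otimes> t"]) (auto simp flip: m_assoc)

text \<open>A solution \<open>s\<close> of \<open>s \<otimes> x s = t\<close> equals
  \<open>t \<otimes> inv a\<close> for the symbol \<open>a = x s\<close>, so solutions correspond to
  symbols \<open>a\<close> with \<open>x (t \<otimes> inv a) = a\<close>. For finite
  \<open>A\<close>, the condition at each \<open>t\<close> thus reads only finitely many
  coordinates, which makes the space closed.\<close>

lemma bij_betw_mult_iff:
  assumes "A \<subseteq> carrier G" "x \<in> carrier G \<rightarrow>\<^sub>E A"
  shows "bij_betw (\<lambda>s. s \<otimes> x s) (carrier G) (carrier G) \<longleftrightarrow>
    (\<forall>t\<in>carrier G. \<exists>!a. a \<in> A \<and> x (t \<otimes> inv a) = a)"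
proof -
  have *: "s \<otimes> x s = t \<longleftrightarrow> x s \<in> A \<and> x (t \<otimes> inv (x s)) = x s \<and> s = t \<otimes> inv (x s)"
    if "s \<in> carrier G" "t \<in> carrier G" for s t
  proof -
    have "x s \<in> A" "x s \<in> carrier G" using assms that by (auto simp: PiE_def Pi_def)
    with that show ?thesis
      by (metis inv_solve_right m_closed inv_closed)
  qed
  have ex: "(\<exists>!s. s \<in> carrier G \<and> s \<otimes> x s = t) \<longleftrightarrow> (\<exists>!a. a \<in> A \<and> x (t \<otimes> inv a) = a)"
    if t: "t \<in> carrier G" for t
  proof
    assume "\<exists>!s. s \<in> carrier G \<and> s \<otimes> x s = t"
    then obtain s where s: "s \<in> carrier G" "s \<otimes> x s = t"
      and u: "\<And>s'. s' \<in> carrier G \<Longrightarrow> s' \<otimes> x s' = t \<Longrightarrow> s' = s" by blast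
    have xs: "x s \<in> A \<and> x (t \<otimes> inv (x s)) = x s" using *[OF s(1) t] s by simp
    show "\<exists>!a. a \<in> A \<and> x (t \<otimes> inv a) = a"
    proof (rule ex1I[of _ "x s"], rule xs)
      fix a assume a: "a \<in> A \<and> x (t \<otimes> inv a) = a"
      have aG: "a \<in> carrier G" using a assms by auto
      have "t \<otimes> inv a = s"
        by (rule u) (use a aG t in \<open>auto simp: m_assoc\<close>)
      then show "a = x s" using a by metis
    qed
  next
    assume "\<exists>!a. a \<in> A \<and> x (t \<otimes> inv a) = a"
    then obtain a where a: "a \<in> A" "x (t \<otimes> inv a) = a"
      and u: "\<And>a'. a' \<in> A \<Longrightarrow> x (t \<otimes> inv a') = a' \<Longrightarrow> a' = a" by blast
    have aG: "a \<in> carrier G" using a assms by auto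
    show "\<exists>!s. s \<in> carrier G \<and> s \<otimes> x s = t"
    proof (rule ex1I)
      show "t \<otimes> inv a \<in> carrier G \<and> (t \<otimes> inv a) \<otimes> x (t \<otimes> inv a) = t"
        using a aG t by (auto simp: m_assoc)
      fix s assume "s \<in> carrier G \<and> s \<otimes> x s = t"
      then show "s = t \<otimes> inv a" using *[OF _ t, of s] u by metis
    qed
  qed
  have img: "(\<lambda>s. s \<otimes> x s) \<in> carrier G \<rightarrow> carrier G" using assms by (auto simp: PiE_def Pi_def)
  have "bij_betw (\<lambda>s. s \<otimes> x s) (carrier G) (carrier G) \<longleftrightarrow>
     (\<forall>t\<in>carrier G. \<exists>!s. s \<in> carrier G \<and> s \<otimes> x s = t)"
  proof
    assume "bij_betw (\<lambda>s. s \<otimes> x s) (carrier G) (carrier G)"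
    then show "\<forall>t\<in>carrier G. \<exists>!s. s \<in> carrier G \<and> s \<otimes> x s = t"
      unfolding bij_betw_def inj_on_def by (smt (verit, best) image_iff)
  next
    assume r: "\<forall>t\<in>carrier G. \<exists>!s. s \<in> carrier G \<and> s \<otimes> x s = t"
    have "inj_on (\<lambda>s. s \<otimes> x s) (carrier G)"
    proof (rule inj_onI)
      fix s t assume st: "s \<in> carrier G" "t \<in> carrier G" "s \<otimes> x s = t \<otimes> x t"
      then have "t \<otimes> x t \<in> carrier G" using img by auto
      then show "s = t" using r st by metis
    qed
    moreover have "carrier G \<subseteq> (\<lambda>s. s \<otimes> x s) ` carrier G"
    proof
      fix t assume "t \<in> carrier G"
      then obtain s where "s \<in> carrier G" "s \<otimes> x s = t" using r by blast
      then show "t \<in> (\<lambda>s. s \<otimes> x s) ` carrier G" by blast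
    qed
    ultimately show "bij_betw (\<lambda>s. s \<otimes> x s) (carrier G) (carrier G)"
      using img by (auto simp: bij_betw_def)
  qed
  then show ?thesis using ex by simp
qed

text \<open>The map \<open>t \<mapsto> t \<otimes> left_shift G s x t\<close> is the map of
  \<open>x\<close> conjugated by left translation by \<open>s\<close>.\<close>

lemma left_shift_restricted_perms:
  assumes A: "A \<subseteq> carrier G" and s: "s \<in> carrier G" and x: "x \<in> restricted_perms G A"
  shows "left_shift G s x \<in> restricted_perms G A"
proof -
  have xA: "x \<in> carrier G \<rightarrow>\<^sub>E A" and bij: "bij_betw (\<lambda>u. u \<otimes> x u) (carrier G) (carrier G)"
    using x by (auto simp: restricted_perms_def)
  have "bij_betw ((\<lambda>u. s \<otimes> u) \<circ> (\<lambda>u. u \<otimes> x u) \<circ> (\<lambda>t. inv s \<otimes> t)) (carrier G) (carrier G)"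
    using s by (intro bij_betw_trans[of _ _ "carrier G"] bij bij_betw_left_mult inv_closed)
  moreover have "((\<lambda>u. s \<otimes> u) \<circ> (\<lambda>u. u \<otimes> x u) \<circ> (\<lambda>t. inv s \<otimes> t)) t = t \<otimes> left_shift G s x t"
    if "t \<in> carrier G" for t
  proof -
    have "inv s \<otimes> t \<in> carrier G" using s that by simp
    then have "x (inv s \<otimes> t) \<in> carrier G" using xA A by blast
    then show ?thesis using s that by (simp add: left_shift_def flip: m_assoc)
  qed
  ultimately have "bij_betw (\<lambda>t. t \<otimes> left_shift G s x t) (carrier G) (carrier G)"
    by (rule bij_betw_cong[THEN iffD1, rotated])
  moreover have "left_shift G s x \<in> carrier G \<rightarrow>\<^sub>E A"
    using xA s by (auto simp: left_shift_def)
  ultimately show ?thesis by (simp add: restricted_perms_def)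
qed

lemma left_shift_left_shift_inv:
  assumes "s \<in> carrier G" "x \<in> extensional (carrier G)"
  shows "left_shift G s (left_shift G (inv s) x) = x"
proof (rule extensionalityI[of _ "carrier G"])
  show "left_shift G s (left_shift G (inv s) x) t = x t" if "t \<in> carrier G" for t
    using assms that by (simp add: left_shift_def flip: m_assoc)
qed (use assms in \<open>auto simp: left_shift_def\<close>)

lemma compact_space_restricted_perm_space:
  assumes A: "finite A" "A \<subseteq> carrier G"
  shows "compact_space (restricted_perm_space G A)"
proof -
  let ?P = "product_topology (\<lambda>_. discrete_topology A) (carrier G)"
  define Q where "Q t x \<longleftrightarrow> (\<exists>!a. a \<in> A \<and> x (t \<otimes> inv a) = a)" for t x
  have "closedin ?P {x \<in> carrier G \<rightarrow>\<^sub>E A. Q t x}" for t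
  proof (rule closedin_finitely_determined)
    show "finite ((\<lambda>a. t \<otimes> inv a) ` A)" using A by simp
    fix x y :: "'a \<Rightarrow> 'a"
    assume "\<And>u. u \<in> (\<lambda>a. t \<otimes> inv a) ` A \<Longrightarrow> x u = y u"
    then have "a \<in> A \<and> x (t \<otimes> inv a) = a \<longleftrightarrow> a \<in> A \<and> y (t \<otimes> inv a) = a" for a by auto
    then show "Q t x \<Longrightarrow> Q t y" by (simp add: Q_def)
  qed
  then have "closedin ?P (\<Inter>t\<in>carrier G. {x \<in> carrier G \<rightarrow>\<^sub>E A. Q t x})"
    using carrier_not_empty by (intro closedin_INT) auto
  also have "(\<Inter>t\<in>carrier G. {x \<in> carrier G \<rightarrow>\<^sub>E A. Q t x}) = restricted_perms G A"
  proof -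
    have "x \<in> restricted_perms G A \<longleftrightarrow> x \<in> carrier G \<rightarrow>\<^sub>E A \<and> (\<forall>t\<in>carrier G. Q t x)" for x
      using bij_betw_mult_iff[OF A(2), of x] unfolding restricted_perms_def Q_def by blast
    then show ?thesis using carrier_not_empty by blast
  qed
  finally have "closedin ?P (restricted_perms G A)" .
  moreover have "compact_space ?P"
    using A by (simp add: compact_space_product_topology compact_space_discrete_topology)
  ultimately show ?thesis
    unfolding restricted_perm_space_def
    by (intro compact_space_subtopology closedin_compact_space)
qed

text \<open>An analogue of the Lebesgue number lemma: by compactness, one finite window
  \<open>K\<close> serves all points at once.\<close>

lemma open_cover_cylinders:
  assumes A: "finite A" "A \<subseteq> carrier G" and U: "is_open_cover (restricted_perm_space G A) \<U>"
  shows "\<exists>K. finite K \<and> K \<subseteq> carrier G \<and> (\<forall>x\<in>restricted_perms G A.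
           \<exists>U\<in>\<U>. {y \<in> restricted_perms G A. \<forall>t\<in>K. y t = x t} \<subseteq> U)"
proof -
  let ?X = "restricted_perms G A"
  let ?P = "product_topology (\<lambda>_. discrete_topology A) (carrier G)"
  define cyl where "cyl K x = {y \<in> ?X. \<forall>t\<in>K. y t = x t}" for K x
  have "\<forall>x\<in>?X. \<exists>K. finite K \<and> K \<subseteq> carrier G \<and> (\<exists>U\<in>\<U>. cyl K x \<subseteq> U)"
  proof
    fix x assume x: "x \<in> ?X"
    then obtain U where U1: "U \<in> \<U>" "x \<in> U" "openin (restricted_perm_space G A) U"
      using U by (auto simp: is_open_cover_def)
    then obtain W where W: "openin ?P W" "U = W \<inter> ?X"
      by (auto simp: restricted_perm_space_def openin_subtopology)
    then obtain V where V: "finite {i \<in> carrier G. V i \<noteq> A}" "x \<in> Pi\<^sub>E (carrier G) V"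
        "Pi\<^sub>E (carrier G) V \<subseteq> W"
      using U1 unfolding openin_product_topology_alt by (auto 0 4)
    \<comment> \<open>Only these coordinates are constrained by the basic box, so they form the
      window of \<open>x\<close>.\<close>
    let ?K = "{i \<in> carrier G. V i \<noteq> A}"
    have "cyl ?K x \<subseteq> U"
    proof
      fix y assume y: "y \<in> cyl ?K x"
      then have yA: "y \<in> carrier G \<rightarrow>\<^sub>E A" by (auto simp: cyl_def restricted_perms_def)
      have "y i \<in> V i" if "i \<in> carrier G" for i
        using y yA V(2) that by (cases "V i = A") (auto simp: cyl_def PiE_def Pi_def)
      then have "y \<in> Pi\<^sub>E (carrier G) V" using yA by (auto simp: PiE_def)
      then show "y \<in> U" using V(3) W(2) y by (auto simp: cyl_def)
    qed
    then show "\<exists>K. finite K \<and> K \<subseteq> carrier G \<and> (\<exists>U\<in>\<U>. cyl K x \<subseteq> U)" using V U1 by blast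
  qed
  then obtain \<kappa> where \<kappa>: "\<And>x. x \<in> ?X \<Longrightarrow> finite (\<kappa> x) \<and> \<kappa> x \<subseteq> carrier G \<and> (\<exists>U\<in>\<U>. cyl (\<kappa> x) x \<subseteq> U)"
    by metis
  have "openin (restricted_perm_space G A) (cyl (\<kappa> x) x)" if x: "x \<in> ?X" for x
  proof -
    have "openin ?P {y \<in> carrier G \<rightarrow>\<^sub>E A. \<forall>t\<in>\<kappa> x. y t = x t}"
      using \<kappa>[OF x] by (intro openin_finitely_determined[of "\<kappa> x"]) auto
    moreover have "cyl (\<kappa> x) x = {y \<in> carrier G \<rightarrow>\<^sub>E A. \<forall>t\<in>\<kappa> x. y t = x t} \<inter> ?X"
      by (auto simp: cyl_def restricted_perms_def)
    ultimately show ?thesis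
      unfolding restricted_perm_space_def openin_subtopology by blast
  qed
  moreover have "?X \<subseteq> (\<Union>x\<in>?X. cyl (\<kappa> x) x)" by (auto simp: cyl_def)
  ultimately have "\<exists>\<F>. finite \<F> \<and> \<F> \<subseteq> (\<lambda>x. cyl (\<kappa> x) x) ` ?X \<and> ?X \<subseteq> \<Union>\<F>"
    using compact_space_restricted_perm_space[OF A]
    unfolding compact_space_def compactin_def topspace_restricted_perm_space
    by (elim conjE allE[of _ "(\<lambda>x. cyl (\<kappa> x) x) ` ?X"]) blast
  then obtain \<F> where \<F>: "finite \<F>" "\<F> \<subseteq> (\<lambda>x. cyl (\<kappa> x) x) ` ?X" "?X \<subseteq> \<Union>\<F>"
    by blast
  then obtain Y where Y: "Y \<subseteq> ?X" "finite Y" "\<F> = (\<lambda>x. cyl (\<kappa> x) x) ` Y"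
    by (meson finite_subset_image)
  show ?thesis
  \<comment> \<open>Each \<open>x\<close> agrees on \<open>\<kappa> y\<close> with the centre
    \<open>y\<close> of some chosen cylinder, so the cylinder of \<open>x\<close> over the larger
    window stays inside that of \<open>y\<close>.\<close>
  proof (intro exI[of _ "\<Union>y\<in>Y. \<kappa> y"] conjI ballI)
    fix x assume "x \<in> ?X"
    then obtain y where y: "y \<in> Y" "x \<in> cyl (\<kappa> y) y" using \<F> Y by auto
    then have "{z \<in> ?X. \<forall>t\<in>\<Union>y\<in>Y. \<kappa> y. z t = x t} \<subseteq> cyl (\<kappa> y) y"
      by (auto simp: cyl_def)
    then show "\<exists>U\<in>\<U>. {z \<in> ?X. \<forall>t\<in>\<Union>y\<in>Y. \<kappa> y. z t = x t} \<subseteq> U"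
      using \<kappa>[of y] y(1) Y(1) by blast
  qed (use Y \<kappa> in auto)
qed

section \<open>From covers to patterns and from patterns to injections\<close>

text \<open>If two points agree on \<open>F <#> K\<close>, then for each \<open>s \<in> F\<close>
  their shifts by \<open>inv s\<close> agree on \<open>K\<close> and so lie in a common member of
  the cover. One member of the join per pattern therefore suffices.\<close>

lemma cover_number_le_patterns:
  assumes A: "finite A" "A \<subseteq> carrier G" and U: "is_open_cover (restricted_perm_space G A) \<U>"
    and K: "finite K" "K \<subseteq> carrier G"
      "\<And>x. x \<in> restricted_perms G A \<Longrightarrow>
         \<exists>U\<in>\<U>. {y \<in> restricted_perms G A. \<forall>t\<in>K. y t = x t} \<subseteq> U"
    and F: "finite F" "F \<noteq> {}" "F \<subseteq> carrier G"
  shows "cover_number (restricted_perm_space G A) (cover_join (left_shift G) \<U> F)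
           \<le> card ((\<lambda>x. restrict x (F <#> K)) ` restricted_perms G A)"
proof -
  let ?X = "restricted_perms G A"
  let ?\<rho> = "\<lambda>x. restrict x (F <#> K)"
  let ?P = "?\<rho> ` ?X"
  have shiftX: "left_shift G s x \<in> ?X" if "s \<in> carrier G" "x \<in> ?X" for s x
    using left_shift_restricted_perms[OF A(2)] that by blast
  have "\<forall>x\<in>?X. \<exists>U. U \<in> \<U> \<and> {y \<in> ?X. \<forall>t\<in>K. y t = x t} \<subseteq> U" using K(3) by blast
  from bchoice[OF this] obtain V where V: "\<And>x. x \<in> ?X \<Longrightarrow> V x \<in> \<U>"
      "\<And>x. x \<in> ?X \<Longrightarrow> {y \<in> ?X. \<forall>t\<in>K. y t = x t} \<subseteq> V x"
    by blast
  define rep where "rep = inv_into ?X ?\<rho>"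
  have rep: "rep p \<in> ?X \<and> ?\<rho> (rep p) = p" if "p \<in> ?P" for p
    unfolding rep_def using inv_into_into[OF that] f_inv_into_f[OF that] by blast
  \<comment> \<open>The member of the join for the pattern \<open>p\<close>, read off from the
    chosen representative \<open>rep p\<close>.\<close>
  define W where "W p = (\<Inter>s\<in>F. left_shift G s ` V (left_shift G (inv s) (rep p)))" for p
  have FK: "finite (F <#> K)" "F <#> K \<subseteq> carrier G"
    using F K by (auto simp: set_mult_def)
  have "?P \<subseteq> (F <#> K) \<rightarrow>\<^sub>E A"
    using FK by (auto simp: restricted_perms_def)
  then have finP: "finite ?P"
    by (rule finite_subset) (use FK A in \<open>simp add: finite_PiE\<close>)
  have Wjoin: "W p \<in> cover_join (left_shift G) \<U> F" if "p \<in> ?P" for p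
    unfolding W_def cover_join_def
    using V(1) shiftX rep[OF that] F(3)
    by (intro CollectI exI[of _ "\<lambda>s. V (left_shift G (inv s) (rep p))"]) auto
  \<comment> \<open>A subcover must have union exactly the space; since \<open>F\<close> is
    nonempty, the intersection over \<open>F\<close> stays inside it.\<close>
  have WX: "W p \<subseteq> ?X" if "p \<in> ?P" for p
  proof
    fix z assume z: "z \<in> W p"
    obtain s where s: "s \<in> F" using F by blast
    then obtain v where v: "v \<in> V (left_shift G (inv s) (rep p))" "z = left_shift G s v"
      using z by (auto simp: W_def)
    have "V (left_shift G (inv s) (rep p)) \<in> \<U>"
      using V(1) shiftX rep[OF that] F(3) s by auto
    then have "v \<in> ?X" using v U by (auto simp: is_open_cover_def)
    then show "z \<in> ?X" using v shiftX s F by auto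
  qed
  have cov: "z \<in> W (?\<rho> z)" if z: "z \<in> ?X" for z
    unfolding W_def
  proof
    fix s assume s: "s \<in> F"
    then have sG: "s \<in> carrier G" using F by blast
    let ?x = "rep (?\<rho> z)"
    have x: "?x \<in> ?X" "?\<rho> ?x = ?\<rho> z" using rep z by auto
    have "left_shift G (inv s) z t = left_shift G (inv s) ?x t" if "t \<in> K" for t
    proof -
      have "s \<otimes> t \<in> F <#> K" using s that by (auto simp: set_mult_def)
      then have "?x (s \<otimes> t) = z (s \<otimes> t)" using fun_cong[OF x(2), of "s \<otimes> t"] by simp
      then show ?thesis using sG that K by (auto simp: left_shift_def)
    qed
    then have "left_shift G (inv s) z \<in> V (left_shift G (inv s) ?x)"
      using V(2)[OF shiftX[OF inv_closed[OF sG] x(1)]] shiftX[OF inv_closed[OF sG] z] by blast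
    moreover have "z = left_shift G s (left_shift G (inv s) z)"
      using left_shift_left_shift_inv[OF sG] z by (simp add: restricted_perms_def PiE_def)
    ultimately show "z \<in> left_shift G s ` V (left_shift G (inv s) ?x)" by blast
  qed
  have "cover_number (restricted_perm_space G A) (cover_join (left_shift G) \<U> F) \<le> card (W ` ?P)"
    unfolding cover_number_def
  proof (rule wellorder_Inf_le1, rule imageI, intro CollectI conjI)
    show "\<Union>(W ` ?P) = topspace (restricted_perm_space G A)"
      using WX cov by auto
  qed (use Wjoin finP in auto)
  also have "\<dots> \<le> card ?P" using finP by (rule card_image_le)
  finally show ?thesis .
qed

text \<open>Cancelling \<open>s\<close> recovers a pattern \<open>p\<close> from the injection
  \<open>s \<mapsto> s \<otimes> p s\<close>, whose value at \<open>s\<close> lies in the translate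
  \<open>sA\<close> of size at most \<open>card A\<close>.\<close>

lemma card_patterns_le:
  assumes A: "finite A" "A \<subseteq> carrier G" and E: "finite E" "E \<subseteq> carrier G"
  shows "real (card ((\<lambda>x. restrict x E) ` restricted_perms G A))
     \<le> real (card (E <#> A) choose card E) * exp (real (card E) * ln_fact_mean (card A))"
proof -
  let ?P = "(\<lambda>x. restrict x E) ` restricted_perms G A"
  let ?R = "\<lambda>s. (\<lambda>a. s \<otimes> a) ` A"
  let ?S = "{\<sigma> \<in> (\<Pi>\<^sub>E s\<in>E. ?R s). inj_on \<sigma> E}"
  let ?\<phi> = "\<lambda>p. \<lambda>s\<in>E. s \<otimes> p s"
  have xA: "x s \<in> A" if "x \<in> restricted_perms G A" "s \<in> E" for x s
    using that E by (auto simp: restricted_perms_def)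
  have "card ?P \<le> card ?S"
  proof (rule card_inj_on_le)
    show "inj_on ?\<phi> ?P"
    proof (rule inj_onI)
      fix p q assume "p \<in> ?P" "q \<in> ?P" and eq: "?\<phi> p = ?\<phi> q"
      then obtain x y where *: "x \<in> restricted_perms G A" "y \<in> restricted_perms G A"
        and pq: "p = restrict x E" "q = restrict y E" by blast
      have "x s = y s" if s: "s \<in> E" for s
      proof -
        have "s \<otimes> x s = s \<otimes> y s" using fun_cong[OF eq, of s] s pq by simp
        moreover have "s \<in> carrier G" "x s \<in> carrier G" "y s \<in> carrier G"
          using s E A xA * by auto
        ultimately show ?thesis by simp
      qed
      then show "p = q" unfolding pq by (rule restrict_ext)
    qed
    show "?\<phi> ` ?P \<subseteq> ?S"
    proof (rule image_subsetI)
      fix p assume "p \<in> ?P"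
      then obtain x where x: "x \<in> restricted_perms G A" "p = restrict x E" by blast
      have "?\<phi> p \<in> (\<Pi>\<^sub>E s\<in>E. ?R s)" using xA[OF x(1)] x(2) by auto
      moreover have "inj_on (\<lambda>s. s \<otimes> x s) E"
        using x(1) E by (auto simp: restricted_perms_def bij_betw_def intro: inj_on_subset)
      then have "inj_on (?\<phi> p) E" by (simp add: inj_on_def x(2))
      ultimately show "?\<phi> p \<in> ?S" by blast
    qed
    show "finite ?S"
      by (rule finite_subset[of _ "\<Pi>\<^sub>E s\<in>E. ?R s"]) (use A E in \<open>auto intro: finite_PiE\<close>)
  qed
  also have "real (card ?S)
      \<le> real (card (E <#> A) choose card E) * exp (real (card E) * ln_fact_mean (card A))"
    using A E by (intro card_inj_selections) (auto simp: set_mult_def card_image_le)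
  finally show ?thesis by simp
qed

section \<open>The entropy estimate\<close>

text \<open>With \<open>E = F <#> K\<close>, the sizes of \<open>F\<close>, \<open>E\<close> and
  \<open>E <#> A\<close> increase and, by almost invariance under \<open>K <#> A\<close>, span at
  most \<open>d * card F\<close>. So few images are possible in \<open>card_patterns_le\<close>, and
  \<open>card E\<close> is close to \<open>card F\<close>.\<close>

lemma entropy_ratio_le:
  assumes A: "finite A" "A \<noteq> {}" "A \<subseteq> carrier G"
    and U: "is_open_cover (restricted_perm_space G A) \<U>"
    and K: "finite K" "K \<subseteq> carrier G" "\<one> \<in> K"
      "\<And>x. x \<in> restricted_perms G A \<Longrightarrow>
         \<exists>U\<in>\<U>. {y \<in> restricted_perms G A. \<forall>t\<in>K. y t = x t} \<subseteq> U"
    and F: "finite F" "F \<noteq> {}" "F \<subseteq> carrier G"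
    and inv: "real (card (sym_diff (F <#> (K <#> A)) F)) \<le> d * real (card F)"
    and x: "0 < x" "x \<le> 1"
  shows "ln (real (cover_number (restricted_perm_space G A) (cover_join (left_shift G) \<U> F))) / real (card F)
    \<le> ln_fact_mean (card A) + ((1 + d) * x + d * (ln (1 / x) + ln_fact_mean (card A)))"
proof -
  define E where "E = F <#> K"
  define f n N where "f = real (card F)" and "n = card E" and "N = card (E <#> A)"
  define g where "g = ln_fact_mean (card A)"
  define c where "c = cover_number (restricted_perm_space G A) (cover_join (left_shift G) \<U> F)"
  have EA: "E <#> A = F <#> (K <#> A)"
    unfolding E_def using F K A by (simp add: set_mult_assoc)
  have E: "finite E" "E \<subseteq> carrier G" "F \<subseteq> E"
  proof -
    show "finite E" "E \<subseteq> carrier G" using F K by (auto simp: E_def set_mult_def)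
    show "F \<subseteq> E" using F K(3) by (force simp: E_def set_mult_def)
  qed
  have finEA: "finite (E <#> A)" using E A by (auto simp: set_mult_def)
  have fpos: "f > 0" using F by (simp add: f_def card_gt_0_iff)
  have fn: "f \<le> real n" unfolding f_def n_def using E by (simp add: card_mono)
  obtain a where a: "a \<in> A" using A by blast
  \<comment> \<open>Right translation by one \<open>a \<in> A\<close> embeds \<open>E\<close> into
    \<open>E <#> A\<close>.\<close>
  have "card E = card ((\<lambda>s. s \<otimes> a) ` E)"
    using a A E by (intro card_image[symmetric] inj_onI) (auto simp: subset_iff)
  also have "\<dots> \<le> card (E <#> A)"
    using finEA a by (intro card_mono) (auto simp: set_mult_def)
  finally have nN: "n \<le> N" by (simp add: n_def N_def)
  have "E <#> A \<subseteq> F \<union> sym_diff (F <#> (K <#> A)) F" unfolding EA by auto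
  then have "N \<le> card (F \<union> sym_diff (F <#> (K <#> A)) F)"
    unfolding N_def using F finEA by (intro card_mono) (auto simp: EA)
  also have "\<dots> \<le> card F + card (sym_diff (F <#> (K <#> A)) F)" by (rule card_Un_le)
  finally have "real N \<le> f + real (card (sym_diff (F <#> (K <#> A)) F))" by (simp add: f_def)
  with inv have Nf: "real N \<le> (1 + d) * f" by (simp add: f_def algebra_simps)
  have g0: "g \<ge> 0" by (simp add: g_def ln_fact_mean_nonneg)
  have l0: "ln (1 / x) \<ge> 0" using x by simp
  have "real c \<le> real (card ((\<lambda>x. restrict x E) ` restricted_perms G A))"
    unfolding c_def E_def using cover_number_le_patterns[OF A(1,3) U K(1,2,4) F] by simp
  also have "\<dots> \<le> real (N choose n) * exp (real n * g)"
    unfolding N_def n_def g_def using A E by (intro card_patterns_le)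
  finally have c_le: "real c \<le> real (N choose n) * exp (real n * g)" .
  have bpos: "real (N choose n) \<ge> 1" using nN by (simp add: Suc_le_eq)
  have "ln (real c) \<le> ln (real (N choose n) * exp (real n * g))"
  \<comment> \<open>Here \<open>ln 0 = 0\<close>, so the right-hand side has to be shown
    nonnegative.\<close>
  proof (cases "c = 0")
    case True
    have "1 \<le> real (N choose n) * exp (real n * g)"
      using mult_mono[OF bpos, of 1 "exp (real n * g)"] g0 by simp
    then show ?thesis using True by simp
  qed (use c_le in \<open>subst ln_le_cancel_iff, auto\<close>)
  \<comment> \<open>Passing to the complement makes the lower index small:
    \<open>N - n \<le> d * f\<close>.\<close>
  also have "\<dots> = ln (real (N choose (N - n))) + real n * g"
    using bpos nN by (simp add: ln_mult binomial_symmetric[OF nN])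
  also have "\<dots> \<le> (real N * x + real (N - n) * ln (1 / x)) + real n * g"
    using x by (intro add_right_mono ln_binomial_le) auto
  also have "\<dots> \<le> ((1 + d) * f * x + (d * f) * ln (1 / x)) + ((1 + d) * f) * g"
    using Nf nN fn x g0 l0
    by (intro add_mono mult_right_mono) (auto simp: of_nat_diff algebra_simps)
  also have "\<dots> = f * (g + ((1 + d) * x + d * (ln (1 / x) + g)))"
    by (simp add: algebra_simps)
  finally show ?thesis
    using fpos by (simp add: c_def f_def g_def divide_le_eq mult.commute)
qed

lemma eventually_right_invariance:
  assumes "finite K" "K \<noteq> {}" "K \<subseteq> carrier G" "d > 0"
  shows "\<forall>\<^sub>F F in right_invariance G. finite F \<and> F \<noteq> {} \<and> F \<subseteq> carrier G \<and>
           real (card (sym_diff (F <#> K) F)) < d * real (card F)"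
  unfolding right_invariance_def
  by (rule eventually_INF1[of "(K, d)"]) (use assms in \<open>auto simp: eventually_principal\<close>)

theorem topological_entropy_restricted_perm_space_le:
  assumes A: "finite A" "A \<noteq> {}" "A \<subseteq> carrier G"
  shows "topological_entropy G (restricted_perm_space G A) (left_shift G)
           \<le> ereal (ln_fact_mean (card A))"
  unfolding topological_entropy_def
proof (rule SUP_least, rule ereal_le_epsilon2)
  fix \<U> and e :: real
  assume "\<U> \<in> {\<U>. is_open_cover (restricted_perm_space G A) \<U>}" and e: "e > 0"
  then have U: "is_open_cover (restricted_perm_space G A) \<U>" by simp
  obtain K0 where K0: "finite K0" "K0 \<subseteq> carrier G"
    "\<forall>x\<in>restricted_perms G A.
       \<exists>U\<in>\<U>. {y \<in> restricted_perms G A. \<forall>t\<in>K0. y t = x t} \<subseteq> U"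
    using open_cover_cylinders[OF A(1,3) U] by blast
  \<comment> \<open>Enlarging the window only shrinks cylinders, and the identity ensures
    \<open>F \<subseteq> F <#> K\<close>.\<close>
  define K where "K = insert \<one> K0"
  have K: "finite K" "K \<subseteq> carrier G" "\<one> \<in> K" using K0 by (auto simp: K_def)
  have KU: "\<exists>U\<in>\<U>. {y \<in> restricted_perms G A. \<forall>t\<in>K. y t = x t} \<subseteq> U"
    if "x \<in> restricted_perms G A" for x
    using bspec[OF K0(3) that] unfolding K_def by blast
  define g where "g = ln_fact_mean (card A)"
  \<comment> \<open>The error has two halves: \<open>x \<le> e / 4\<close> and
    \<open>d \<le> 1\<close> give \<open>(1 + d) * x \<le> e / 2\<close>, and \<open>d\<close>,
    chosen after \<open>x\<close>, gives \<open>d * (ln (1 / x) + g) \<le> e / 2\<close>. The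
    summand 1 in the denominator of \<open>d\<close> keeps it positive when \<open>x = 1\<close> and
    \<open>g = 0\<close>.\<close>
  define x where "x = min 1 (e / 4)"
  define d where "d = min 1 (e / (2 * (ln (1 / x) + g + 1)))"
  have x: "0 < x" "x \<le> 1" "x \<le> e / 4" using e by (auto simp: x_def)
  have "g \<ge> 0" "ln (1 / x) \<ge> 0" using x by (auto simp: g_def ln_fact_mean_nonneg)
  then have pos: "ln (1 / x) + g + 1 > 0" by linarith
  have d: "d > 0" "d \<le> 1" "d \<le> e / (2 * (ln (1 / x) + g + 1))"
    using e pos by (auto simp: d_def)
  have "d * (ln (1 / x) + g) \<le> d * (ln (1 / x) + g + 1)" using d by simp
  also have "\<dots> \<le> e / 2" using d(3) pos by (simp add: field_simps)
  finally have d1: "d * (ln (1 / x) + g) \<le> e / 2" .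
  have "(1 + d) * x \<le> 2 * (e / 4)" using d x by (intro mult_mono) auto
  with d1 have small: "(1 + d) * x + d * (ln (1 / x) + g) \<le> e" by simp
  have KA: "finite (K <#> A)" "K <#> A \<noteq> {}" "K <#> A \<subseteq> carrier G"
    using K A by (auto simp: set_mult_def)
  show "Limsup (right_invariance G)
      (\<lambda>F. ereal (ln (real (cover_number (restricted_perm_space G A) (cover_join (left_shift G) \<U> F)))
             / real (card F)))
    \<le> ereal (ln_fact_mean (card A)) + ereal e"
  proof (rule Limsup_bounded, rule eventually_mono[OF eventually_right_invariance[OF KA d(1)]])
    fix F assume F: "finite F \<and> F \<noteq> {} \<and> F \<subseteq> carrier G \<and>
      real (card (sym_diff (F <#> (K <#> A)) F)) < d * real (card F)"
    have "ln (real (cover_number (restricted_perm_space G A) (cover_join (left_shift G) \<U> F)))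
        / real (card F) \<le> g + ((1 + d) * x + d * (ln (1 / x) + g))"
      unfolding g_def by (rule entropy_ratio_le[OF A U K KU]) (use F x in auto)
    with small show "ereal (ln (real (cover_number (restricted_perm_space G A)
          (cover_join (left_shift G) \<U> F))) / real (card F))
        \<le> ereal (ln_fact_mean (card A)) + ereal e"
      by (simp add: g_def)
  qed
qed

end

theorem theorem7p8:
  fixes \<Gamma> :: "('g, 'b) monoid_scheme" and A :: "'g set"
  assumes "group \<Gamma>"
    and "infinite (carrier \<Gamma>)"
    and "finitely_generated \<Gamma>"
    and "polynomial_growth \<Gamma>"
    and "finite A" and "A \<noteq> {}" and "A \<subseteq> carrier \<Gamma>"
  shows "topological_entropy \<Gamma> (restricted_perm_space \<Gamma> A) (left_shift \<Gamma>)
           \<le> ereal (1 / real (card A) * ln (fact (card A)))"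
  using group.topological_entropy_restricted_perm_space_le[OF assms(1,5,6,7)]
  by (simp add: ln_fact_mean_def)

end
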